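(* For every integer $n\ge 2$, the only degree-one vertices of the partition graph $G_n$ are the two antenna vertices $(n)$ and $(1^n)$; that is, $(n)$ and $(1^n)$ have degree $1$ in $G_n$, and every other vertex of $G_n$ has degree different from $1$.
   Context: A partition of a positive integer $n$ is a finite weakly decreasing sequence $\lambda=(\lambda_1,\dots,\lambda_\ell)$ of positive integers with sum $n$ (written $\lambda\vdash n$); partitions are identified with their Ferrers diagrams. Exponents denote repeated parts, so $(1^n)$ is the partition of $n$ into $n$ parts equal to $1$, and $(n)$ is the partition with one part. The partition graph $G_n$ is the simple graph whose vertices are the partitions of $n$; two distinct partitions are adjacent if and only if one is obtained from the other by an elementary transfer of one cell of the Ferrers diagram (moving a cell from a removable corner to an addable corner, followed by reordering, with the result different from the original partition). Equivalently: one decreases one part by $1$ and increases another part by $1$, where the increased part may also be a new part of length $0$ (thus creating a new part $1$), deletes any part that became $0$, sorts into weakly decreasing order, and requires that the resulting partition differ from the original. The antenna vertices of $G_n$ are the vertices $(n)$ and $(1^n)$. *)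

theory Defs
  imports Main
begin

definition partitions :: "nat \<Rightarrow> nat list set" where
  "partitions n = {p. sorted_wrt (\<ge>) p \<and> (\<forall>x \<in> set p. x > 0) \<and> sum_list p = n}"

text \<open>
  Moving one cell from part \<open>i\<close> to another part \<open>j\<close>.  The list is padded with one
  empty part, so that \<open>j = length p\<close> means that the cell forms a new part of size 1.
  Afterwards an empty part is deleted and the parts are reordered.
\<close>
definition move_cell :: "nat list \<Rightarrow> nat \<Rightarrow> nat \<Rightarrow> nat list" where
  "move_cell p i j =
     (let q = p @ [0]
      in rev (sort (filter (\<lambda>x. x > 0) (q[i := q ! i - 1, j := q ! j + 1]))))"

definition elementary_transfer :: "nat list \<Rightarrow> nat list \<Rightarrow> bool" where
  "elementary_transfer p q \<longleftrightarrow>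
     q \<noteq> p \<and> (\<exists>i j. i < length p \<and> j \<le> length p \<and> i \<noteq> j \<and> q = move_cell p i j)"

text \<open>A simple graph is a pair of a vertex set and a set of two-element sets of vertices.\<close>
type_synonym 'a graph = "'a set \<times> 'a set set"

definition degree :: "'a graph \<Rightarrow> 'a \<Rightarrow> nat" where
  "degree G v = card {e \<in> snd G. v \<in> e}"

definition partition_graph :: "nat \<Rightarrow> nat list graph" where
  "partition_graph n =
     (partitions n,
      {{p, q} | p q. p \<in> partitions n \<and> q \<in> partitions n \<and> p \<noteq> q \<and>
                     (elementary_transfer p q \<or> elementary_transfer q p)})"

definition antenna_vertices :: "nat \<Rightarrow> nat list set" where
  "antenna_vertices n = {[n], replicate n 1}"

end

theory Submission
  imports Defs "HOL-Library.Multiset"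
begin

text \<open>
  Sorted lists of positive parts carry the same information as multisets of positive numbers, and
  on multisets a transfer is the replacement of two entries \<open>a > 0\<close> and \<open>b\<close> (possibly \<open>b = 0\<close>,
  the empty part) by \<open>a - 1\<close> and \<open>b + 1\<close>.  Replacing \<open>b + 1\<close> and \<open>a - 1\<close> in the same way undoes
  this, so the relation is symmetric and all neighbours of a partition are found by looking only
  at the transfers that leave it.

  From \<open>(n)\<close> the only possible move splits off a single cell.  In \<open>(1\<^sup>n)\<close> every part is \<open>1\<close>; sending
  its cell to a new part changes nothing, so the cell must join another part, and the result is
  always \<open>(2, 1\<^sup>n\<^sup>-\<^sup>2)\<close>.  Hence the antenna vertices have exactly one neighbour
  (\<open>neighbours_single_part\<close>, \<open>neighbours_all_ones\<close>).

  Any other partition has a largest part \<open>x \<ge> 2\<close> and a further part \<open>y\<close>.  Splitting a cell off \<open>x\<close>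
  increases the number of parts; moving a cell from \<open>y\<close> to \<open>x\<close> does not increase it, but does
  increase the largest part.  These are two different neighbours (\<open>two_neighbours\<close>).
\<close>

section \<open>Transfers on multisets of parts\<close>

text \<open>
  The multiset \<open>R\<close> holds the entries that stay fixed.  Entries \<open>0\<close> are allowed in \<open>R\<close> and for \<open>b\<close>
  and are filtered away on both sides, which makes the relation manifestly symmetric: creating
  and deleting a part are the same step read in opposite directions.
\<close>
definition mset_transfer :: "nat multiset \<Rightarrow> nat multiset \<Rightarrow> bool" where
  "mset_transfer M N \<longleftrightarrow>
     (\<exists>R a b. a > 0 \<and> M = filter_mset (\<lambda>x. x > 0) (R + {#a, b#}) \<and>
              N = filter_mset (\<lambda>x. x > 0) (R + {#a - 1, b + 1#}))"

lemma mset_transfer_sym: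
  assumes "mset_transfer M N"
  shows "mset_transfer N M"
proof -
  obtain R a b where "a > 0"
    and M: "M = filter_mset (\<lambda>x. x > 0) (R + {#a, b#})"
    and N: "N = filter_mset (\<lambda>x. x > 0) (R + {#a - 1, b + 1#})"
    using assms unfolding mset_transfer_def by blast
  have "N = filter_mset (\<lambda>x. x > 0) (R + {#b + 1, a - 1#})"
    unfolding N by (simp add: add_mset_commute)
  moreover have "M = filter_mset (\<lambda>x. x > 0) (R + {#b + 1 - 1, a - 1 + 1#})"
    unfolding M using \<open>a > 0\<close> by (simp add: add_mset_commute)
  ultimately show ?thesis
    unfolding mset_transfer_def by (metis add_gr_0 zero_less_one)
qed

lemma sum_mset_filter_pos: "sum_mset (filter_mset (\<lambda>x. x > 0) M) = sum_mset (M :: nat multiset)"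
  by (induction M) auto

lemma mset_transfer_sum:
  assumes "mset_transfer M N"
  shows "sum_mset N = sum_mset M"
  using assms unfolding mset_transfer_def by (auto simp: sum_mset_filter_pos)

text \<open>
  The fixed entries are expressed through their positions, so that the remainder is literally the
  same multiset for a list and for its update at \<open>i\<close> and \<open>j\<close>; this also covers equal entries.
\<close>
lemma mset_split_two_positions:
  assumes "i < length xs" "j < length xs" "i \<noteq> j"
  shows "mset xs = image_mset ((!) xs) (mset_set ({..<length xs} - {i, j})) + {#xs ! i, xs ! j#}"
proof -
  have "{..<length xs} = insert i (insert j ({..<length xs} - {i, j}))"
    using assms by auto
  then have "mset_set {..<length xs} = mset_set (insert i (insert j ({..<length xs} - {i, j})))"
    by simp
  also have "\<dots> = {#i, j#} + mset_set ({..<length xs} - {i, j})"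
    using assms by simp
  finally have "image_mset ((!) xs) (mset_set {..<length xs})
      = image_mset ((!) xs) (mset_set ({..<length xs} - {i, j})) + {#xs ! i, xs ! j#}"
    by simp
  moreover have "image_mset ((!) xs) (mset_set {..<length xs}) = mset xs"
    by (metis map_nth mset_map mset_upt atLeast0LessThan)
  ultimately show ?thesis by simp
qed

lemma mset_transfer_move_cell:
  assumes pos: "\<forall>x\<in>set p. x > 0" and "i < length p" "j \<le> length p" "i \<noteq> j"
  shows "mset_transfer (mset p) (mset (move_cell p i j))"
proof -
  define q where "q = p @ [0]"
  define q' where "q' = q[i := q ! i - 1, j := q ! j + 1]"
  define R where "R = image_mset ((!) q) (mset_set ({..<length q} - {i, j}))"
  have ij: "i < length q" "j < length q" "i \<noteq> j"
    using assms by (auto simp: q_def)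
  have "mset q = R + {#q ! i, q ! j#}"
    unfolding R_def by (rule mset_split_two_positions[OF ij])
  moreover have "mset p = filter_mset (\<lambda>x. x > 0) (mset q)"
    using pos by (simp add: q_def flip: mset_filter)
  ultimately have p: "mset p = filter_mset (\<lambda>x. x > 0) (R + {#q ! i, q ! j#})"
    by simp
  have "mset q' = image_mset ((!) q') (mset_set ({..<length q'} - {i, j})) + {#q' ! i, q' ! j#}"
    using ij by (intro mset_split_two_positions) (auto simp: q'_def)
  also have "image_mset ((!) q') (mset_set ({..<length q'} - {i, j})) = R"
    unfolding R_def by (auto simp: q'_def intro!: image_mset_cong)
  also have "{#q' ! i, q' ! j#} = {#q ! i - 1, q ! j + 1#}"
    using ij by (simp add: q'_def)
  finally have "mset q' = R + {#q ! i - 1, q ! j + 1#}" .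
  moreover have "mset (move_cell p i j) = filter_mset (\<lambda>x. x > 0) (mset q')"
    by (simp add: move_cell_def Let_def q'_def q_def)
  ultimately have "mset (move_cell p i j)
      = filter_mset (\<lambda>x. x > 0) (R + {#q ! i - 1, q ! j + 1#})"
    by simp
  moreover have "q ! i > 0"
    using assms by (simp add: q_def nth_append)
  ultimately show ?thesis
    unfolding mset_transfer_def using p by blast
qed

lemma partition_eqI:
  assumes "p \<in> partitions n" "q \<in> partitions m" "mset p = mset q"
  shows "p = q"
proof -
  have "rev p = sort p" "rev q = sort p"
    using assms by (auto simp: partitions_def sorted_wrt_rev intro!: properties_for_sort[symmetric])
  then show ?thesis by (metis rev_rev_ident)
qed

lemma move_cell_in_partitions:
  assumes "p \<in> partitions n" "i < length p" "j \<le> length p" "i \<noteq> j"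
  shows "move_cell p i j \<in> partitions n"
proof -
  have "sum_list (move_cell p i j) = sum_list p"
    using mset_transfer_sum[OF mset_transfer_move_cell, of p i j] assms
    by (simp add: partitions_def flip: sum_mset_sum_list)
  moreover have "sorted_wrt (\<ge>) (move_cell p i j)"
    by (simp add: move_cell_def Let_def sorted_wrt_rev)
  moreover have "\<forall>x\<in>set (move_cell p i j). x > 0"
    by (simp add: move_cell_def Let_def)
  ultimately show ?thesis
    using assms by (simp add: partitions_def)
qed

section \<open>Neighbours and degree\<close>

lemma fst_partition_graph: "fst (partition_graph n) = partitions n"
  by (simp add: partition_graph_def)

definition neighbours :: "nat \<Rightarrow> nat list \<Rightarrow> nat list set" where
  "neighbours n p = {q \<in> partitions n. p \<noteq> q \<and> (elementary_transfer p q \<or> elementary_transfer q p)}"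

lemma degree_eq_card_neighbours:
  assumes "p \<in> partitions n"
  shows "degree (partition_graph n) p = card (neighbours n p)"
proof -
  have "{e \<in> snd (partition_graph n). p \<in> e} = (\<lambda>q. {p, q}) ` neighbours n p"
    using assms by (force simp: partition_graph_def neighbours_def)
  moreover have "inj_on (\<lambda>q. {p, q}) (neighbours n p)"
    by (auto simp: inj_on_def doubleton_eq_iff)
  ultimately show ?thesis
    by (simp add: degree_def card_image)
qed

lemma neighbours_mset_transfer:
  assumes "p \<in> partitions n" "q \<in> neighbours n p"
  shows "mset_transfer (mset p) (mset q)"
proof -
  have *: "mset_transfer (mset r) (mset s)"
    if "r \<in> partitions n" "elementary_transfer r s" for r s
    using that mset_transfer_move_cell by (auto simp: elementary_transfer_def partitions_def)
  show ?thesis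
    using assms *[of p q] *[of q p] mset_transfer_sym by (auto simp: neighbours_def)
qed

lemma move_cell_in_neighbours:
  assumes "p \<in> partitions n" "i < length p" "j \<le> length p" "i \<noteq> j" "move_cell p i j \<noteq> p"
  shows "move_cell p i j \<in> neighbours n p"
  using assms move_cell_in_partitions[OF assms(1-4)]
  by (auto simp: neighbours_def elementary_transfer_def)

section \<open>The antenna vertices have degree one\<close>

text \<open>
  Once all transfers that leave the multiset of \<open>p\<close> and change it lead to the same multiset, a
  single move that changes \<open>p\<close> already gives the whole neighbourhood.
\<close>
lemma neighbours_eq_singleton:
  assumes p: "p \<in> partitions n"
    and move: "i < length p" "j \<le> length p" "i \<noteq> j" "move_cell p i j \<noteq> p"
    and unique: "\<And>N. mset_transfer (mset p) N \<Longrightarrow> N \<noteq> mset p \<Longrightarrow> N = M"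
  shows "neighbours n p = {move_cell p i j}"
proof -
  have mem: "move_cell p i j \<in> neighbours n p"
    by (rule move_cell_in_neighbours[OF p move])
  have M: "mset q = M" if q: "q \<in> neighbours n p" for q
  proof (rule unique)
    show "mset_transfer (mset p) (mset q)"
      using neighbours_mset_transfer[OF p q] .
    show "mset q \<noteq> mset p"
      using q partition_eqI[OF p] by (auto simp: neighbours_def)
  qed
  have "q = move_cell p i j" if "q \<in> neighbours n p" for q
    using partition_eqI[of q n "move_cell p i j" n] that mem M by (simp add: neighbours_def)
  then show ?thesis using mem by blast
qed

lemma neighbours_single_part:
  assumes "n \<ge> 2"
  shows "neighbours n [n] = {move_cell [n] 0 1}"
proof (rule neighbours_eq_singleton)
  show "[n] \<in> partitions n"
    using assms by (simp add: partitions_def)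
  have "length (move_cell [n] 0 1) = 2"
    using assms by (simp add: move_cell_def)
  then show "move_cell [n] 0 1 \<noteq> [n]" by auto
  fix N assume "mset_transfer (mset [n]) N"
  then obtain R a b where "a > 0"
    and M: "{#n#} = filter_mset (\<lambda>x. x > 0) (R + {#a, b#})"
    and N: "N = filter_mset (\<lambda>x. x > 0) (R + {#a - 1, b + 1#})"
    unfolding mset_transfer_def by auto
  have "b = 0" "a = n" "filter_mset (\<lambda>x. x > 0) R = {#}"
    using M \<open>a > 0\<close> by (auto split: if_splits)
  then show "N = {#n - 1, 1#}"
    using N assms by simp
qed auto

lemma neighbours_all_ones:
  assumes "n \<ge> 2"
  shows "neighbours n (replicate n 1) = {move_cell (replicate n 1) 0 1}"
proof (rule neighbours_eq_singleton)
  show "replicate n 1 \<in> partitions n"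
    by (simp add: partitions_def sum_list_replicate sorted_wrt_iff_nth_less)
  have "2 \<in> set (move_cell (replicate n 1) 0 1)"
    using assms by (cases n; cases "n - 1") (auto simp: move_cell_def set_insort_key)
  then show "move_cell (replicate n 1) 0 1 \<noteq> replicate n 1"
    by (metis in_set_replicate numeral_eq_one_iff semiring_norm(85))
  fix N assume "mset_transfer (mset (replicate n 1)) N" and ne: "N \<noteq> mset (replicate n 1)"
  then obtain R a b where "a > 0"
    and M: "replicate_mset n 1 = filter_mset (\<lambda>x. x > 0) (R + {#a, b#})"
    and N: "N = filter_mset (\<lambda>x. x > 0) (R + {#a - 1, b + 1#})"
    unfolding mset_transfer_def by auto
  have one: "x = 1" if "x \<in># R + {#a, b#}" "x > 0" for x
  proof -
    have "x \<in># replicate_mset n 1" unfolding M using that by auto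
    then show ?thesis by (simp split: if_splits)
  qed
  have "a = 1" using one[of a] \<open>a > 0\<close> by simp
  \<comment> \<open>Moving the only cell of a part to the empty part reproduces the same multiset.\<close>
  have "b \<noteq> 0"
  proof
    assume "b = 0"
    then have "N = replicate_mset n 1" using M N \<open>a = 1\<close> by simp
    then show False using ne by simp
  qed
  then have "b = 1" using one[of b] by simp
  have "replicate_mset n 1 = filter_mset (\<lambda>x. x > 0) R + {#1, 1#}"
    using M \<open>a = 1\<close> \<open>b = 1\<close> by simp
  then have "filter_mset (\<lambda>x. x > 0) R = replicate_mset n 1 - {#1, 1#}"
    by (metis add_diff_cancel_right')
  then show "N = replicate_mset n 1 - {#1, 1#} + {#2#}"
    using N \<open>a = 1\<close> \<open>b = 1\<close> by simp
qed (use assms in auto)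

section \<open>The other partitions have two neighbours\<close>

text \<open>
  The two neighbours are told apart by their number of parts, and the second one differs from the
  partition itself because its largest part has grown.
\<close>
lemma two_neighbours:
  assumes p: "x # y # zs \<in> partitions n" and "x \<ge> 2"
  obtains q r where "q \<in> neighbours n (x # y # zs)" "r \<in> neighbours n (x # y # zs)" "q \<noteq> r"
proof -
  let ?p = "x # y # zs"
  let ?q = "move_cell ?p 0 (length ?p)" and ?r = "move_cell ?p 1 0"
  have pos: "y > 0" "\<forall>z\<in>set zs. z > 0" and le: "\<forall>z\<in>set ?p. z \<le> x"
    using p by (auto simp: partitions_def)
  have q_len: "length ?q = length ?p + 1"
    using \<open>x \<ge> 2\<close> pos by (simp add: move_cell_def nth_append)
  have r_len: "length ?r \<le> length ?p"
    by (simp add: move_cell_def le_SucI)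
  have "x + 1 \<in> set ?r"
    by (simp add: move_cell_def set_insort_key)
  moreover have "x + 1 \<notin> set ?p" using le by auto
  ultimately have "?r \<noteq> ?p" by metis
  then have "?r \<in> neighbours n ?p"
    by (intro move_cell_in_neighbours p) auto
  moreover have "?q \<noteq> ?p" using q_len by (metis add_eq_self_zero zero_neq_one)
  then have "?q \<in> neighbours n ?p"
    by (intro move_cell_in_neighbours p) auto
  moreover have "?q \<noteq> ?r" using q_len r_len by (metis Suc_eq_plus1 not_less_eq_eq order_refl)
  ultimately show ?thesis using that by blast
qed

lemma partition_cases_antenna:
  assumes p: "p \<in> partitions n" and "n > 0" "p \<notin> antenna_vertices n"
  obtains x y zs where "p = x # y # zs" "x \<ge> 2"
proof (cases p rule: list.exhaust[case_names Nil Cons])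
  case Nil
  then show ?thesis using p \<open>n > 0\<close> by (simp add: partitions_def)
next
  case (Cons x ys)
  have "ys \<noteq> []"
    using assms Cons by (auto simp: partitions_def antenna_vertices_def)
  moreover have "x \<ge> 2"
  proof (rule ccontr)
    assume "\<not> x \<ge> 2"
    then have "\<forall>z\<in>set p. z = 1"
      using p Cons by (fastforce simp: partitions_def)
    then have "p = replicate (length p) 1"
      by (metis replicate_length_same)
    moreover from this have "length p = n"
      using p sum_list_replicate[of "length p" "1 :: nat"] by (simp add: partitions_def)
    ultimately show False using assms by (simp add: antenna_vertices_def)
  qed
  ultimately show ?thesis using that Cons by (cases ys) auto
qed

theorem proposition2p3:
  fixes n :: nat
  assumes "n \<ge> 2"
  shows "{v \<in> fst (partition_graph n). degree (partition_graph n) v = 1} = antenna_vertices n"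
proof (intro equalityI subsetI)
  fix v assume "v \<in> {v \<in> fst (partition_graph n). degree (partition_graph n) v = 1}"
  then have v: "v \<in> partitions n" and "card (neighbours n v) = 1"
    by (auto simp: fst_partition_graph degree_eq_card_neighbours)
  then obtain w where w: "neighbours n v = {w}"
    by (auto simp: card_1_singleton_iff)
  show "v \<in> antenna_vertices n"
  proof (rule ccontr)
    assume "v \<notin> antenna_vertices n"
    then obtain x y zs where "v = x # y # zs" "x \<ge> 2"
      using partition_cases_antenna[OF v] assms by auto
    then show False using two_neighbours v w by (metis singletonD)
  qed
next
  fix v assume "v \<in> antenna_vertices n"
  then have "v \<in> partitions n" "card (neighbours n v) = 1"
    using assms neighbours_single_part neighbours_all_ones
    by (auto simp: antenna_vertices_def partitions_def sum_list_replicate sorted_wrt_iff_nth_less)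
  then show "v \<in> {v \<in> fst (partition_graph n). degree (partition_graph n) v = 1}"
    by (simp add: fst_partition_graph degree_eq_card_neighbours)
qed

end
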